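(* There exists a function $f \colon \mathbb{N} \to \{\pm 1\}$ with the following properties: (1) for every prime $p$, the set $\{ n \in \mathbb{N} : f(n) \neq -f(pn)\}$ has natural density $0$; (2) there exists $\varepsilon > 0$ such that for all sufficiently large $x$, \[ \frac{1}{x} \sum_{n \leq x} f(n) f(n+1) < -\varepsilon ; \] (3) \[ \lim_{H \to \infty} \lim_{x \to \infty} \frac{1}{x} \sum_{n \leq x} \left| \frac{1}{H} \sum_{h \leq H} f(n+h)\, \mathbb{1}_{n+h \equiv 1 \bmod 3} \right| = \frac{1}{3}. \]
   Context: The natural density of $A \subseteq \mathbb{N}$ is $\lim_{x\to\infty} |A\cap[1,x]|/x$. Sums $\sum_{n \le x}$ and $\sum_{h \le H}$ run over positive integers. $\mathbb{1}_{P}$ equals $1$ if the condition $P$ holds and $0$ otherwise. *)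

theory Defs
  imports Complex_Main "HOL-Number_Theory.Cong"
begin

definition has_natural_density :: "nat set \<Rightarrow> real \<Rightarrow> bool" where
  "has_natural_density A d \<longleftrightarrow>
     ((\<lambda>x::real. real (card (A \<inter> {1..nat \<lfloor>x\<rfloor>})) / x) \<longlongrightarrow> d) at_top"

end

(* Let chi be the completely multiplicative function that agrees with the non-principal character modulo 3
   away from multiples of 3 and has chi(3) = 1, and put f(n) = s(n) chi(n) with a sign s(n) that is almost
   always constant on short intervals. Then f(pn) = -f(n) amounts to s(pn) = -chi(p) s(n); on the class
   1 mod 3 the function f is locally constant, which gives (3); and the correlation in (2) is that of chi,
   where each block 3m+1, 3m+2, 3m+3 contributes exactly -1, so that the mean is -1/3.
   For the sign take s(n) = (-1)^floor(t log n). By Kronecker's theorem and the linear independence of the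
   logarithms of the primes, t can be chosen with t log p close to an integer of the parity prescribed by
   chi(p), for all p <= k. As k grows the frequency has to change, and an abrupt change would spoil a positive
   proportion of the integers at some scale. Instead one passes from t to t' in 2k+1 steps, in the j-th of
   which t' is used where the fractional part of t log n is below j/(2k+1): this set is almost invariant
   under multiplication by p <= k, and consecutive steps differ only on a set of density O(1/k). *)
theory Submission
  imports
    Defs
    "HOL-Analysis.Kronecker_Approximation_Theorem"
    "HOL-Library.Discrete_Functions"
    "HOL-Real_Asymp.Real_Asymp"
begin

subsection \<open>Upper density\<close>

text \<open>The sets below, such as windows in \<open>ln n\<close>, need not have a natural density,
  so the argument runs on eventual upper bounds, which are subadditive.\<close>

definition upper_dens_le :: "nat set \<Rightarrow> real \<Rightarrow> bool" where
  "upper_dens_le A d \<longleftrightarrow> (\<forall>\<^sub>F N in sequentially. real (card (A \<inter> {1..N})) \<le> d * real N)"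

definition null_dens :: "nat set \<Rightarrow> bool" where
  "null_dens A \<longleftrightarrow> (\<forall>d>0. upper_dens_le A d)"

text \<open>Counts start at 1, so the inclusion is only asked for at positive integers; this keeps
  conventions such as the value of \<open>ln 0\<close> out of later arguments.\<close>

lemma upper_dens_le_mono:
  assumes "upper_dens_le B d" "A \<inter> {1..} \<subseteq> B" "d \<le> e"
  shows "upper_dens_le A e"
  unfolding upper_dens_le_def
proof (rule eventually_mono[OF assms(1)[unfolded upper_dens_le_def]])
  fix N assume N: "real (card (B \<inter> {1..N})) \<le> d * real N"
  have "card (A \<inter> {1..N}) \<le> card (B \<inter> {1..N})"
    using assms(2) by (intro card_mono) auto
  also have "real \<dots> \<le> d * real N" by (rule N)
  also have "\<dots> \<le> e * real N" using assms(3) by (simp add: mult_right_mono)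
  finally show "real (card (A \<inter> {1..N})) \<le> e * real N" by simp
qed

lemma upper_dens_le_Un:
  assumes "upper_dens_le A d" "upper_dens_le B e"
  shows "upper_dens_le (A \<union> B) (d + e)"
  unfolding upper_dens_le_def
proof (rule eventually_elim2[OF assms[unfolded upper_dens_le_def]])
  fix N assume *: "real (card (A \<inter> {1..N})) \<le> d * real N" "real (card (B \<inter> {1..N})) \<le> e * real N"
  have "card ((A \<union> B) \<inter> {1..N}) \<le> card (A \<inter> {1..N}) + card (B \<inter> {1..N})"
    by (simp add: Int_Un_distrib2 card_Un_le)
  with * show "real (card ((A \<union> B) \<inter> {1..N})) \<le> (d + e) * real N"
    by (simp add: algebra_simps)
qed

text \<open>Multiplication by \<open>p\<close> injects the set below \<open>N\<close> into
  \<open>A\<close> below \<open>p * N\<close>; the longer range costs the factor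
  \<open>p\<close>.\<close>

lemma upper_dens_le_vimage_mult:
  assumes "upper_dens_le A d" "p > 0"
  shows "upper_dens_le {n. p * n \<in> A} (real p * d)"
proof -
  have "filterlim (\<lambda>N. p * N) sequentially sequentially"
    using assms(2) by (simp add: filterlim_subseq strict_mono_def)
  then have "\<forall>\<^sub>F N in sequentially. real (card (A \<inter> {1..p * N})) \<le> d * real (p * N)"
    using assms(1) unfolding upper_dens_le_def filterlim_iff by blast
  then show ?thesis
    unfolding upper_dens_le_def
  proof (rule eventually_mono)
    fix N assume N: "real (card (A \<inter> {1..p * N})) \<le> d * real (p * N)"
    have "card ({n. p * n \<in> A} \<inter> {1..N}) \<le> card (A \<inter> {1..p * N})"
      using assms(2) by (intro card_inj_on_le[of "\<lambda>n. p * n"]) (auto simp: inj_on_def)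
    with N show "real (card ({n. p * n \<in> A} \<inter> {1..N})) \<le> real p * d * real N"
      by (simp add: algebra_simps)
  qed
qed

lemma upper_dens_le_finite:
  assumes "finite A" "d > 0"
  shows "upper_dens_le A d"
  unfolding upper_dens_le_def
proof -
  have "\<forall>\<^sub>F N in sequentially. real (card A) \<le> d * real N"
    using assms(2) by real_asymp
  then show "\<forall>\<^sub>F N in sequentially. real (card (A \<inter> {1..N})) \<le> d * real N"
  proof (rule eventually_mono)
    fix N assume "real (card A) \<le> d * real N"
    moreover have "card (A \<inter> {1..N}) \<le> card A" using assms(1) by (intro card_mono) auto
    ultimately show "real (card (A \<inter> {1..N})) \<le> d * real N" by linarith
  qed
qed

lemma null_dens_mono: "null_dens B \<Longrightarrow> A \<inter> {1..} \<subseteq> B \<Longrightarrow> null_dens A"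
  unfolding null_dens_def using upper_dens_le_mono by blast

lemma null_dens_Un:
  assumes "null_dens A" "null_dens B"
  shows "null_dens (A \<union> B)"
  unfolding null_dens_def
proof (intro allI impI)
  fix d :: real assume "d > 0"
  then have "upper_dens_le (A \<union> B) (d / 2 + d / 2)"
    using assms by (intro upper_dens_le_Un) (auto simp: null_dens_def)
  then show "upper_dens_le (A \<union> B) d" by simp
qed

lemma null_dens_UN:
  assumes "finite I" "\<And>i. i \<in> I \<Longrightarrow> null_dens (A i)"
  shows "null_dens (\<Union>i\<in>I. A i)"
  using assms
proof (induction I rule: finite_induct)
  case empty
  then show ?case by (simp add: null_dens_def upper_dens_le_finite)
qed (auto intro!: null_dens_Un)

text \<open>The factor 2 is crude: it absorbs \<open>N + h\<close> into \<open>2 * N\<close> once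
  \<open>N \<ge> h\<close>.\<close>

lemma upper_dens_le_vimage_add:
  assumes "upper_dens_le A d" "d \<ge> 0"
  shows "upper_dens_le {n. n + h \<in> A} (2 * d)"
proof -
  have "filterlim (\<lambda>N. N + h) sequentially sequentially"
    by (simp add: filterlim_subseq strict_mono_def)
  then have "\<forall>\<^sub>F N in sequentially. real (card (A \<inter> {1..N + h})) \<le> d * real (N + h)"
    using assms(1) unfolding upper_dens_le_def filterlim_iff by blast
  moreover have "\<forall>\<^sub>F N in sequentially. N \<ge> h" by (rule eventually_ge_at_top)
  ultimately show ?thesis
    unfolding upper_dens_le_def
  proof eventually_elim
    case (elim N)
    have "card ({n. n + h \<in> A} \<inter> {1..N}) \<le> card (A \<inter> {1..N + h})"
      by (intro card_inj_on_le[of "\<lambda>n. n + h"]) (auto simp: inj_on_def)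
    moreover have "d * real (N + h) \<le> d * real (2 * N)"
      using elim assms(2) by (intro mult_left_mono) auto
    ultimately show ?case using elim by (simp add: algebra_simps)
  qed
qed

lemma null_dens_vimage_add:
  assumes "null_dens A"
  shows "null_dens {n. n + h \<in> A}"
  unfolding null_dens_def
proof (intro allI impI)
  fix d :: real assume "d > 0"
  then show "upper_dens_le {n. n + h \<in> A} d"
    using upper_dens_le_vimage_add[of A "d / 2" h] assms by (simp add: null_dens_def)
qed

lemma null_dens_iff_tendsto:
  "null_dens A \<longleftrightarrow> (\<lambda>N. real (card (A \<inter> {1..N})) / real N) \<longlonglongrightarrow> 0"
proof
  assume A: "null_dens A"
  show "(\<lambda>N. real (card (A \<inter> {1..N})) / real N) \<longlonglongrightarrow> 0"
  proof (rule tendstoI)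
    fix e :: real assume "e > 0"
    then have "upper_dens_le A (e / 2)" using A by (auto simp: null_dens_def)
    then show "\<forall>\<^sub>F N in sequentially. dist (real (card (A \<inter> {1..N})) / real N) 0 < e"
      unfolding upper_dens_le_def using eventually_gt_at_top[of 0]
    proof eventually_elim
      case (elim N)
      have "real (card (A \<inter> {1..N})) / real N \<le> e / 2"
        using elim by (simp add: divide_simps mult.commute)
      moreover have "e / 2 < e" using \<open>e > 0\<close> by simp
      ultimately have "real (card (A \<inter> {1..N})) / real N < e" by (rule le_less_trans)
      then show ?case by (simp add: dist_real_def)
    qed
  qed
next
  assume lim: "(\<lambda>N. real (card (A \<inter> {1..N})) / real N) \<longlonglongrightarrow> 0"
  show "null_dens A"
    unfolding null_dens_def upper_dens_le_def
  proof (intro allI impI)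
    fix d :: real assume "d > 0"
    with lim have "\<forall>\<^sub>F N in sequentially. dist (real (card (A \<inter> {1..N})) / real N) 0 < d"
      by (rule tendstoD)
    then show "\<forall>\<^sub>F N in sequentially. real (card (A \<inter> {1..N})) \<le> d * real N"
      using eventually_gt_at_top[of 0]
      by eventually_elim (simp add: dist_real_def divide_simps split: if_splits)
  qed
qed

section \<open>Averages: real cutoffs, null modifications, sums with period 3\<close>

lemma tendsto_div_nat_floor:
  fixes a :: "nat \<Rightarrow> real"
  assumes "(\<lambda>N. a N / real N) \<longlonglongrightarrow> L"
  shows "((\<lambda>x::real. a (nat \<lfloor>x\<rfloor>) / x) \<longlongrightarrow> L) at_top"
proof -
  have "filterlim (\<lambda>x::real. nat \<lfloor>x\<rfloor>) sequentially at_top"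
    by (rule filterlim_compose[OF filterlim_nat_sequentially filterlim_floor_sequentially])
  from filterlim_compose[OF assms this]
  have 1: "((\<lambda>x::real. a (nat \<lfloor>x\<rfloor>) / real (nat \<lfloor>x\<rfloor>)) \<longlongrightarrow> L) at_top" .
  have "((\<lambda>x::real. of_int \<lfloor>x\<rfloor> / x) \<longlongrightarrow> 1) at_top" by real_asymp
  from tendsto_mult[OF 1 this]
  have "((\<lambda>x::real. a (nat \<lfloor>x\<rfloor>) / real (nat \<lfloor>x\<rfloor>) * (of_int \<lfloor>x\<rfloor> / x)) \<longlongrightarrow> L) at_top" by simp
  moreover have "\<forall>\<^sub>F x::real in at_top. a (nat \<lfloor>x\<rfloor>) / real (nat \<lfloor>x\<rfloor>) * (of_int \<lfloor>x\<rfloor> / x) = a (nat \<lfloor>x\<rfloor>) / x"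
    using eventually_ge_at_top[of 1]
  proof eventually_elim
    case (elim x)
    then have "\<lfloor>x\<rfloor> \<ge> 1" by (simp only: le_floor_iff of_int_1)
    then have "\<lfloor>x\<rfloor> \<noteq> 0" "0 \<le> \<lfloor>x\<rfloor>" by linarith+
    then have "real (nat \<lfloor>x\<rfloor>) = of_int \<lfloor>x\<rfloor>" "of_int \<lfloor>x\<rfloor> \<noteq> (0::real)"
      by (simp_all only: of_nat_nat of_int_eq_0_iff simp_thms)
    then show ?case by simp
  qed
  ultimately show ?thesis by (rule Lim_transform_eventually)
qed

lemma has_natural_density_0_if_null_dens: "null_dens A \<Longrightarrow> has_natural_density A 0"
  unfolding null_dens_iff_tendsto has_natural_density_def by (rule tendsto_div_nat_floor)

lemma tendsto_average_modify_null:
  fixes g h :: "nat \<Rightarrow> real"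
  assumes h: "(\<lambda>N. (\<Sum>n=1..N. h n) / real N) \<longlonglongrightarrow> L"
    and B: "null_dens B" and eq: "\<And>n. n \<ge> 1 \<Longrightarrow> n \<notin> B \<Longrightarrow> g n = h n"
    and bd: "\<And>n. \<bar>g n - h n\<bar> \<le> C"
  shows "(\<lambda>N. (\<Sum>n=1..N. g n) / real N) \<longlonglongrightarrow> L"
proof -
  have "(\<lambda>N. C * (real (card (B \<inter> {1..N})) / real N)) \<longlonglongrightarrow> C * 0"
    using B unfolding null_dens_iff_tendsto by (rule tendsto_mult_left)
  then have lim: "(\<lambda>N. C * (real (card (B \<inter> {1..N})) / real N)) \<longlonglongrightarrow> 0" by simp
  have "\<bar>(\<Sum>n=1..N. g n) / real N - (\<Sum>n=1..N. h n) / real N\<bar> \<le> C * (real (card (B \<inter> {1..N})) / real N)" for N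
  proof -
    have "\<bar>(\<Sum>n=1..N. g n) - (\<Sum>n=1..N. h n)\<bar> \<le> (\<Sum>n=1..N. \<bar>g n - h n\<bar>)"
      by (simp add: sum_subtractf[symmetric] sum_abs)
    also have "\<dots> = (\<Sum>n\<in>B \<inter> {1..N}. \<bar>g n - h n\<bar>)"
    proof (rule sum.mono_neutral_right)
      show "\<forall>n\<in>{1..N} - B \<inter> {1..N}. \<bar>g n - h n\<bar> = 0"
      proof
        fix n assume "n \<in> {1..N} - B \<inter> {1..N}"
        then have "g n = h n" by (intro eq) auto
        then show "\<bar>g n - h n\<bar> = 0" by simp
      qed
    qed auto
    also have "\<dots> \<le> (\<Sum>n\<in>B \<inter> {1..N}. C)" by (rule sum_mono) (rule bd)
    finally have "\<bar>(\<Sum>n=1..N. g n) - (\<Sum>n=1..N. h n)\<bar> \<le> C * real (card (B \<inter> {1..N}))"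
      by (simp add: mult.commute)
    then show ?thesis
      by (simp add: diff_divide_distrib[symmetric] abs_divide divide_right_mono)
  qed
  then have "(\<lambda>N. (\<Sum>n=1..N. g n) / real N - (\<Sum>n=1..N. h n) / real N) \<longlonglongrightarrow> 0"
    by (intro Lim_null_comparison[OF _ lim]) auto
  from tendsto_add[OF this h] show ?thesis by simp
qed

lemma tendsto_average_mod_3:
  fixes a :: "nat \<Rightarrow> real"
  assumes a: "\<And>m. a (3 * m + 1) + a (3 * m + 2) + a (3 * m + 3) = 3 * c"
    and bd: "\<And>n. \<bar>a n\<bar> \<le> C"
  shows "(\<lambda>N. (\<Sum>n=1..N. a n) / real N) \<longlonglongrightarrow> c"
proof -
  have S3: "(\<Sum>n=1..3*M. a n) = c * real (3 * M)" for M
  proof (induction M)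
    case (Suc M)
    have "{1..3 * Suc M} = insert (3*M+1) (insert (3*M+2) (insert (3*M+3) {1..3*M}))" by auto
    with Suc a[of M] show ?case by (simp add: algebra_simps)
  qed simp
  have C: "C \<ge> 0" using bd[of 0] by linarith
  \<comment> \<open>At most two terms are left over after the complete blocks, each off by at most
    \<open>C + \<bar>c\<bar>\<close>.\<close>
  have bound: "\<bar>(\<Sum>n=1..N. a n) - c * real N\<bar> \<le> 2 * (C + \<bar>c\<bar>)" for N
  proof -
    define M where "M = N div 3"
    consider "N = 3 * M" | "N = Suc (3 * M)" | "N = Suc (Suc (3 * M))"
      unfolding M_def by linarith
    then show ?thesis
      using S3[of M] bd[of "Suc (3 * M)"] bd[of "Suc (Suc (3 * M))"] C
      by cases (auto simp: algebra_simps)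
  qed
  have "(\<lambda>N. 2 * (C + \<bar>c\<bar>) / real N) \<longlonglongrightarrow> 0" by real_asymp
  moreover have "\<forall>\<^sub>F N in sequentially. norm ((\<Sum>n=1..N. a n) / real N - c) \<le> 2 * (C + \<bar>c\<bar>) / real N"
    using eventually_gt_at_top[of 0]
  proof eventually_elim
    case (elim N)
    then have "(\<Sum>n=1..N. a n) / real N - c = ((\<Sum>n=1..N. a n) - c * real N) / real N"
      by (simp add: field_simps)
    then show ?case using bound[of N] by (simp add: abs_divide divide_right_mono)
  qed
  ultimately have "(\<lambda>N. (\<Sum>n=1..N. a n) / real N - c) \<longlonglongrightarrow> 0"
    by (rule Lim_null_comparison[rotated])
  then show ?thesis by (rule LIM_zero_cancel)
qed

subsection \<open>Logarithmic windows\<close>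

text \<open>Convexity: between 0 and \<open>z\<close> the exponential lies below its chord. This
  makes window sizes linear in the width \<open>e\<close>.\<close>

lemma exp_mult_le_chord:
  fixes e z :: real
  assumes "0 \<le> e" "e \<le> 1"
  shows "exp (e * z) - 1 \<le> e * (exp z - 1)"
  using convex_onD[OF exp_convex, of e 0 z] assms by (simp add: algebra_simps)

lemma card_nat_between_le:
  fixes a b :: real
  assumes "a \<le> b"
  shows "real (card {n::nat. a \<le> real n \<and> real n < b}) \<le> b - a + 1"
proof -
  have "int ` {n::nat. a \<le> real n \<and> real n < b} \<subseteq> {\<lceil>a\<rceil>..<\<lceil>b\<rceil>}"
    by (auto simp: ceiling_le_iff less_ceiling_iff)
  then have "card {n::nat. a \<le> real n \<and> real n < b} \<le> card {\<lceil>a\<rceil>..<\<lceil>b\<rceil>}"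
    by (intro card_inj_on_le[of int]) auto
  also have "real \<dots> \<le> b - a + 1" 
  proof -
    have "\<lceil>a\<rceil> \<le> \<lceil>b\<rceil>" using assms by (rule ceiling_mono)
    then have "real (card {\<lceil>a\<rceil>..<\<lceil>b\<rceil>}) = of_int \<lceil>b\<rceil> - of_int \<lceil>a\<rceil>" by simp
    then show ?thesis by linarith
  qed
  finally show ?thesis by simp
qed

text \<open>For each integer part \<open>j\<close> of \<open>t * ln n - c\<close>, the admissible
  \<open>n\<close> fill one interval. The lengths grow geometrically with ratio
  \<open>exp (1 / t)\<close>, so the last one governs the sum; rounding costs 1 per interval, whence
  the logarithmic term.\<close>

lemma card_log_window_le:
  fixes t c e :: real
  assumes t: "t > 0" and e: "0 < e" "e \<le> 1" and c: "0 \<le> c" "c < 1" and N: "N \<ge> 1"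
  shows "real (card {n\<in>{1..N}. frac (t * ln (real n) - c) < e}) \<le> e * exp (1 / t) * real N + (t * ln (real N) + 2)"
proof -
  define q where "q = exp (1 / t)"
  have q: "q > 1" using t by (simp add: q_def)
  define m where "m = nat (\<lfloor>t * ln (real N) - c\<rfloor> + 1)"
  \<comment> \<open>\<open>I i\<close> belongs to the integer part \<open>i - 1\<close>: since
    \<open>0 \<le> c < 1\<close>, the integer part can be -1 but no less.\<close>
  define I where "I i = {n::nat. exp ((c + real i - 1) / t) \<le> real n \<and> real n < exp ((c + real i - 1 + e) / t)}" for i
  have lnN: "t * ln (real N) \<ge> 0" using t N by simp
  have m: "of_int \<lfloor>t * ln (real N) - c\<rfloor> = real m - 1" 
  proof -
    have "\<lfloor>t * ln (real N) - c\<rfloor> + 1 \<ge> 0" using lnN c by linarith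
    then show ?thesis unfolding m_def by simp
  qed
  have fin: "finite (I i)" for i
  proof (rule finite_subset)
    show "I i \<subseteq> {..nat \<lceil>exp ((c + real i - 1 + e) / t)\<rceil>}"
      unfolding I_def by (auto; linarith)
  qed simp
  have sub: "{n\<in>{1..N}. frac (t * ln (real n) - c) < e} \<subseteq> (\<Union>i\<le>m. I i)"
  proof safe
    fix n assume n: "n \<in> {1..N}" and fr: "frac (t * ln (real n) - c) < e"
    define j where "j = \<lfloor>t * ln (real n) - c\<rfloor>"
    have "t * ln (real n) \<ge> 0" using t n by simp
    then have j0: "j + 1 \<ge> 0" unfolding j_def using c by linarith
    have "j \<le> \<lfloor>t * ln (real N) - c\<rfloor>" unfolding j_def using n t by (intro floor_mono) simp
    then have jm: "nat (j + 1) \<le> m" unfolding m_def by simp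
    have eq: "real (nat (j + 1)) - 1 = of_int j" using j0 by simp
    have "of_int j \<le> t * ln (real n) - c" "t * ln (real n) - c < of_int j + e"
      using fr unfolding j_def frac_def by linarith+
    then have "(c + of_int j) / t \<le> ln (real n)" "ln (real n) < (c + of_int j + e) / t"
      using t by (auto simp: field_simps)
    then have "exp ((c + of_int j) / t) \<le> exp (ln (real n))" "exp (ln (real n)) < exp ((c + of_int j + e) / t)"
      by (simp_all only: exp_le_cancel_iff exp_less_cancel_iff)
    moreover have "exp (ln (real n)) = real n" using n by simp
    ultimately have "exp ((c + of_int j) / t) \<le> real n" "real n < exp ((c + of_int j + e) / t)" by simp_all
    then have "n \<in> I (nat (j + 1))" unfolding I_def by (simp add: eq add_diff_eq[symmetric])
    then show "n \<in> (\<Union>i\<le>m. I i)" using jm by blast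
  qed
  have qpow: "q ^ i = exp (real i / t)" for i
    using exp_of_nat_mult[of i "1 / t"] by (simp add: q_def)
  have cardI: "real (card (I i)) \<le> e * (q - 1) * exp ((c - 1) / t) * q ^ i + 1" for i
  proof -
    have "real (card (I i)) \<le> exp ((c + real i - 1 + e) / t) - exp ((c + real i - 1) / t) + 1"
      unfolding I_def by (rule card_nat_between_le) (use t e in \<open>simp add: divide_right_mono\<close>)
    also have "exp ((c + real i - 1 + e) / t) - exp ((c + real i - 1) / t) = exp ((c - 1) / t) * q ^ i * (exp (e * (1 / t)) - 1)"
    proof -
      have 1: "(c + real i - 1) / t = (c - 1) / t + real i / t"
        "(c + real i - 1 + e) / t = (c - 1) / t + real i / t + e * (1 / t)"
        by (simp_all add: add_divide_distrib diff_divide_distrib)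
      show ?thesis unfolding 1 by (simp add: exp_add qpow right_diff_distrib)
    qed
    also have "\<dots> \<le> exp ((c - 1) / t) * q ^ i * (e * (q - 1))"
      unfolding q_def using e by (intro mult_left_mono exp_mult_le_chord) auto
    finally show ?thesis by (simp add: mult_ac)
  qed
  have "real (card {n\<in>{1..N}. frac (t * ln (real n) - c) < e}) \<le> real (\<Sum>i\<le>m. card (I i))"
  proof -
    have "card {n\<in>{1..N}. frac (t * ln (real n) - c) < e} \<le> card (\<Union>i\<le>m. I i)"
      by (rule card_mono[OF _ sub]) (simp add: fin)
    also have "\<dots> \<le> (\<Sum>i\<le>m. card (I i))" by (rule card_UN_le) simp
    finally show ?thesis by (simp only: of_nat_le_iff)
  qed
  also have "\<dots> \<le> (\<Sum>i\<le>m. e * (q - 1) * exp ((c - 1) / t) * q ^ i + 1)"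
    unfolding of_nat_sum by (intro sum_mono cardI)
  also have "\<dots> = e * exp ((c - 1) / t) * ((q - 1) * (\<Sum>i\<le>m. q ^ i)) + (real m + 1)"
    by (simp add: sum.distrib sum_distrib_left mult_ac)
  \<comment> \<open>The factor \<open>q - 1\<close> from the chord estimate cancels the denominator
    of the geometric sum.\<close>
  also have "(q - 1) * (\<Sum>i\<le>m. q ^ i) = q ^ Suc m - 1"
    by (simp only: power_diff_1_eq lessThan_Suc_atMost)
  also have "e * exp ((c - 1) / t) * (q ^ Suc m - 1) \<le> e * exp ((c - 1) / t) * q ^ Suc m"
    using e by (intro mult_left_mono) auto
  also have "e * exp ((c - 1) / t) * q ^ Suc m = e * exp ((c + real m) / t)"
    unfolding qpow mult.assoc exp_add[symmetric] by (simp add: add_divide_distrib diff_divide_distrib)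
  also have "\<dots> \<le> e * (exp (1 / t) * real N)"
  proof (rule mult_left_mono)
    have "c + real m \<le> 1 + t * ln (real N)" using m by linarith
    then have "(c + real m) / t \<le> (1 + t * ln (real N)) / t" using t by (simp add: divide_right_mono)
    also have "\<dots> = 1 / t + ln (real N)" using t by (simp add: add_divide_distrib)
    finally have "(c + real m) / t \<le> 1 / t + ln (real N)" .
    then have "exp ((c + real m) / t) \<le> exp (1 / t + ln (real N))" by simp
    then show "exp ((c + real m) / t) \<le> exp (1 / t) * real N" using N by (simp add: exp_add)
  qed (use e in auto)
  also have "real m + 1 \<le> t * ln (real N) + 2" using m c by linarith
  finally show ?thesis by (simp add: mult.assoc)
qed

text \<open>For small \<open>t\<close> one period of \<open>t * ln (real n)\<close> covers a wide multiplicative range, and the natural density of a window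
  need not be comparable to its length; this is the factor \<open>exp (1 / t)\<close>.\<close>
lemma upper_dens_le_log_window:
  fixes t c e :: real
  assumes t: "t > 0" and e: "0 < e"
  shows "upper_dens_le {n. frac (t * ln (real n) - c) < e} (2 * exp (1 / t) * e)"
proof (cases "e \<le> 1")
  case True
  \<comment> \<open>The logarithmic error is absorbed by a second copy of the main term, hence the
    factor 2.\<close>
  have "\<forall>\<^sub>F N::nat in sequentially. t * ln (real N) + 2 \<le> e * exp (1 / t) * real N"
    using t e by real_asymp
  then show ?thesis
    unfolding upper_dens_le_def using eventually_ge_at_top[of 1]
  proof eventually_elim
    case (elim N)
    have "frac (u - c) = frac (u - frac c)" for u :: real
    proof -
      have eq: "u - frac c = (u - c) + of_int \<lfloor>c\<rfloor>" by (simp add: frac_def)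
      show ?thesis unfolding eq by (simp only: frac_def floor_add_int[symmetric])
    qed
    then have "{n. frac (t * ln (real n) - c) < e} \<inter> {1..N} = {n\<in>{1..N}. frac (t * ln (real n) - frac c) < e}" by auto
    then show ?case
      using card_log_window_le[OF t e True frac_ge_0 frac_lt_1, of N c] elim by (simp add: mult_ac)
  qed
next
  case False
  \<comment> \<open>For \<open>e > 1\<close> the claimed bound is weaker than the trivial count
    \<open>N\<close>.\<close>
  have "1 \<le> 2 * exp (1 / t) * e"
    using False t mult_mono[of 1 "exp (1 / t)" 1 e] by simp
  then have "card (A \<inter> {1..N}) \<le> 2 * exp (1 / t) * e * real N" for A N
    using card_mono[of "{1..N}" "A \<inter> {1..N}"] mult_right_mono[of 1 "2 * exp (1 / t) * e" "real N"] by simp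
  then show ?thesis unfolding upper_dens_le_def by simp
qed

subsection \<open>Frequencies adapted to the primes\<close>

text \<open>Unique factorization: with positive and negative coefficients on opposite sides,
  exponentiating gives two equal products of prime powers, whose multiplicities at \<open>q\<close>
  agree.\<close>

lemma sum_int_ln_prime_eq_0:
  fixes u :: "nat \<Rightarrow> int"
  assumes P: "finite P" "\<And>p. p \<in> P \<Longrightarrow> prime p"
    and eq: "(\<Sum>p\<in>P. of_int (u p) * ln (real p)) = 0" and q: "q \<in> P"
  shows "u q = 0"
proof -
  define a b where "a p = nat (u p)" and "b p = nat (- u p)" for p
  have u: "of_int (u p) = real (a p) - real (b p)" for p
    unfolding a_def b_def by (cases "u p \<ge> 0") auto
  have pos: "real p > 0" if "p \<in> P" for p using P(2)[OF that] by (simp add: prime_gt_0_nat)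
  have ln_prod: "ln (real (\<Prod>p\<in>P. p ^ c p)) = (\<Sum>p\<in>P. real (c p) * ln (real p))" for c :: "nat \<Rightarrow> nat"
    using P(1) pos by (simp add: ln_prod ln_realpow)
  have "(\<Sum>p\<in>P. real (a p) * ln (real p)) = (\<Sum>p\<in>P. real (b p) * ln (real p))"
    using eq by (simp add: u left_diff_distrib sum_subtractf)
  then have "ln (real (\<Prod>p\<in>P. p ^ a p)) = ln (real (\<Prod>p\<in>P. p ^ b p))"
    unfolding ln_prod .
  moreover have "real (\<Prod>p\<in>P. p ^ c p) > 0" for c
    unfolding of_nat_prod of_nat_power using pos by (intro prod_pos) auto
  ultimately have "real (\<Prod>p\<in>P. p ^ a p) = real (\<Prod>p\<in>P. p ^ b p)"
    using ln_inj_iff by blast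
  then have "(\<Prod>p\<in>P. p ^ a p) = (\<Prod>p\<in>P. p ^ b p)" by (simp only: of_nat_eq_iff)
  then have "multiplicity q (\<Prod>p\<in>P. p ^ a p) = multiplicity q (\<Prod>p\<in>P. p ^ b p)" by simp
  then have "a q = b q"
    using multiplicity_prod_prime_powers[OF P(1), of q] P(2) q by simp
  then show ?thesis unfolding a_def b_def by linarith
qed

lemma Kronecker_ln_primes:
  fixes \<alpha> :: "nat \<Rightarrow> real"
  assumes P: "finite P" "\<And>p. p \<in> P \<Longrightarrow> prime p" and \<epsilon>: "\<epsilon> > 0"
  obtains t h where "\<And>p. p \<in> P \<Longrightarrow> \<bar>t * ln (real p) - of_int (h p) - \<alpha> p\<bar> < \<epsilon>"
proof -
  \<comment> \<open>Kronecker's theorem requires independence over the integers, so the reals are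
    viewed as an integer module.\<close>
  interpret Modules.module "(\<lambda>r. (*) (real_of_int r))"
    by (simp add: Modules.module.intro distrib_left mult.commute)
  obtain g where g: "bij_betw g {..<card P} P"
    using ex_bij_betw_nat_finite[OF P(1)] by (auto simp: atLeast0LessThan)
  define \<theta> where "\<theta> i = ln (real (g i))" for i
  have inj_ln: "inj_on (\<lambda>p. ln (real p)) P"
    by (auto simp: inj_on_def P(2) prime_gt_0_nat)
  have im: "\<theta> ` {..<card P} = (\<lambda>p. ln (real p)) ` P"
    unfolding \<theta>_def using bij_betw_imp_surj_on[OF g] by (metis image_image)
  have inj: "inj_on \<theta> {..<card P}"
    using comp_inj_on[of g "{..<card P}" "\<lambda>p. ln (real p)"] g inj_ln
    by (simp add: bij_betw_def \<theta>_def[abs_def] comp_def)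
  have "independent (\<theta> ` {..<card P})"
    unfolding im
  proof
    assume "dependent ((\<lambda>p. ln (real p)) ` P)"
    then obtain u where u: "\<exists>v\<in>(\<lambda>p. ln (real p)) ` P. u v \<noteq> 0"
      "(\<Sum>v\<in>(\<lambda>p. ln (real p)) ` P. real_of_int (u v) * v) = 0"
      using P(1) by (subst (asm) dependent_finite) auto
    then have "(\<Sum>p\<in>P. real_of_int (u (ln (real p))) * ln (real p)) = 0"
      by (simp add: sum.reindex[OF inj_ln])
    from sum_int_ln_prime_eq_0[OF P this] u(1) show False by auto
  qed
  then obtain t h where th: "\<And>i. i < card P \<Longrightarrow> \<bar>t * \<theta> i - of_int (h i) - \<alpha> (g i)\<bar> < \<epsilon>"
    using Kronecker_thm_1[of \<theta> "card P" \<epsilon> "\<alpha> \<circ> g"] inj \<epsilon> by (metis comp_apply)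
  show thesis
  proof
    fix p assume "p \<in> P"
    then obtain i where "i < card P" "p = g i" using g by (auto simp: bij_betw_def)
    moreover have "inv_into {..<card P} g (g i) = i" if "i < card P" for i
      using g that by (simp add: bij_betw_def inv_into_f_f)
    ultimately show "\<bar>t * ln (real p) - of_int (h (inv_into {..<card P} g p)) - \<alpha> p\<bar> < \<epsilon>"
      using th[of i] by (simp add: \<theta>_def)
  qed
qed

text \<open>Parities are prescribed by aiming at 0 or 1/2 modulo 1 and doubling the frequency.
  Oddness at the prime 3 keeps the frequency away from 0, so \<open>exp (1 / t)\<close> is bounded
  uniformly in \<open>K\<close>.\<close>

lemma exists_frequency:
  fixes e :: "nat \<Rightarrow> bool" and \<epsilon> :: real
  assumes e3: "\<not> e 3" and \<epsilon>: "0 < \<epsilon>" "\<epsilon> \<le> 1 / 2"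
  shows "\<exists>t>0. exp (1 / t) \<le> 9 \<and>
    (\<forall>p\<le>K. prime p \<longrightarrow> (\<exists>M::int. \<bar>t * ln (real p) - of_int M\<bar> < \<epsilon> \<and> (even M \<longleftrightarrow> e p)))"
proof -
  \<comment> \<open>3 is included even when \<open>K < 3\<close>, because the lower bound on the
    frequency comes from it.\<close>
  define P where "P = insert 3 {p. prime p \<and> p \<le> K}"
  have P: "finite P" "\<And>p. p \<in> P \<Longrightarrow> prime p"
    unfolding P_def by auto
  obtain t h where th: "\<And>p. p \<in> P \<Longrightarrow> \<bar>t * ln (real p) - of_int (h p) - (if e p then 0 else 1 / 2)\<bar> < \<epsilon> / 2"
    using Kronecker_ln_primes[OF P, of "\<epsilon> / 2" "\<lambda>p. if e p then 0 else 1 / 2"] \<epsilon> by auto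
  \<comment> \<open>Doubling turns \<open>h p + 1 / 2\<close> into an odd integer and
    \<open>h p\<close> into an even one; the absolute value at most negates it, which preserves
    parity.\<close>
  define s where "s = 2 * \<bar>t\<bar>"
  have M: "\<exists>M::int. \<bar>s * ln (real p) - of_int M\<bar> < \<epsilon> \<and> (even M \<longleftrightarrow> e p)" if "p \<in> P" for p
  proof -
    define M where "M = (if t \<ge> 0 then 1 else - 1) * (2 * h p + (if e p then 0 else 1))"
    have "\<bar>s * ln (real p) - of_int M\<bar> < \<epsilon>"
      using th[OF that] unfolding s_def M_def by (auto split: if_splits simp: abs_if)
    moreover have "even M \<longleftrightarrow> e p" unfolding M_def by auto
    ultimately show ?thesis by blast
  qed
  obtain M :: int where M3: "\<bar>s * ln 3 - of_int M\<bar> < \<epsilon>" "odd M"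
    using M[of 3] e3 by (auto simp: P_def)
  have s0: "s * ln 3 \<ge> 0" by (simp add: s_def)
  have "M \<ge> 1"
  proof -
    have "of_int M > (-1::real)" using M3(1) s0 \<epsilon> by linarith
    then have "M \<ge> 0" by simp
    with M3(2) show ?thesis by (cases "M = 0") auto
  qed
  then have half: "s * ln 3 \<ge> 1 / 2" using M3(1) \<epsilon> by linarith
  then have "s > 0" by (cases "s = 0") (auto simp: s_def)
  then have "1 / s \<le> 2 * ln 3" using half by (simp add: field_simps)
  then have "exp (1 / s) \<le> exp (2 * ln 3)" by simp
  also have "\<dots> = (9::real)" using exp_of_nat_mult[of 2 "ln (3::real)"] by simp
  finally show ?thesis using \<open>s > 0\<close> M by (auto simp: P_def)
qed

subsection \<open>Slowly changing waves\<close>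

text \<open>The first assumption keeps \<open>w\<close> at least \<epsilon> away from the integers,
  so the error of \<open>v\<close> cannot carry the sum across one.\<close>

lemma floor_add_near_int:
  fixes w v \<epsilon> :: real
  assumes "\<not> frac (w + \<epsilon>) < 2 * \<epsilon>" "\<bar>v - of_int M\<bar> < \<epsilon>"
  shows "\<lfloor>w + v\<rfloor> = \<lfloor>w\<rfloor> + M"
proof -
  define k where "k = \<lfloor>w + \<epsilon>\<rfloor>"
  have "of_int k + 2 * \<epsilon> \<le> w + \<epsilon>" "w + \<epsilon> < of_int k + 1"
    using assms(1) unfolding frac_def k_def by linarith+
  then have "\<lfloor>w + v\<rfloor> = k + M" "\<lfloor>w\<rfloor> = k"
    using assms(2) by (auto intro!: floor_unique)
  then show ?thesis by simp
qed

text \<open>The sign (-1)^floor(t log n), with \<open>True\<close> standing for +1.\<close>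

definition log_wave :: "real \<Rightarrow> nat \<Rightarrow> bool" where
  "log_wave t n \<longleftrightarrow> even \<lfloor>t * ln (real n)\<rfloor>"

text \<open>For \<open>0 \<le> a \<le> 1\<close> the condition says that the fractional part of \<open>t * ln n\<close> is at least \<open>a\<close>. As \<open>a\<close> moves
  from 0 to 1 the wave of frequency \<open>t\<close> is gradually replaced by the one of frequency \<open>t'\<close>.\<close>
definition mixed_wave :: "real \<Rightarrow> real \<Rightarrow> real \<Rightarrow> nat \<Rightarrow> bool" where
  "mixed_wave t t' a n = (if \<lfloor>t * ln (real n)\<rfloor> = \<lfloor>t * ln (real n) - a\<rfloor> then log_wave t n else log_wave t' n)"

lemma mixed_wave_0: "mixed_wave t t' 0 = log_wave t"
  by (rule ext) (simp add: mixed_wave_def)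

lemma mixed_wave_1: "mixed_wave t t' 1 = log_wave t'"
  by (rule ext) (simp add: mixed_wave_def)

text \<open>Here one of \<open>t * ln n\<close>, \<open>t * ln n - a\<close>,
  \<open>t' * ln n\<close> lies within \<epsilon> of an integer. The shifts are written as
  subtractions to match the window estimate.\<close>

definition wave_boundary :: "real \<Rightarrow> real \<Rightarrow> real \<Rightarrow> real \<Rightarrow> nat set" where
  "wave_boundary t t' a \<epsilon> = {n. frac (t * ln (real n) - (- \<epsilon>)) < 2 * \<epsilon>} \<union>
     {n. frac (t * ln (real n) - (a - \<epsilon>)) < 2 * \<epsilon>} \<union> {n. frac (t' * ln (real n) - (- \<epsilon>)) < 2 * \<epsilon>}"

lemma upper_dens_le_wave_boundary:
  assumes "t > 0" "t' > 0" "exp (1 / t) \<le> 9" "exp (1 / t') \<le> 9" "\<epsilon> > 0"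
  shows "upper_dens_le (wave_boundary t t' a \<epsilon>) (108 * \<epsilon>)"
proof -
  \<comment> \<open>A window of width \<open>2 * \<epsilon>\<close> has bound 2 * 9 * 2\<epsilon> =
    36\<epsilon>, and there are three of them.\<close>
  have "upper_dens_le {n. frac (s * ln (real n) - c) < 2 * \<epsilon>} (36 * \<epsilon>)" if "s > 0" "exp (1 / s) \<le> 9" for s c
    by (rule upper_dens_le_mono[OF upper_dens_le_log_window[of s "2 * \<epsilon>" c]]) (use that assms(5) in auto)
  then have "upper_dens_le (wave_boundary t t' a \<epsilon>) (36 * \<epsilon> + 36 * \<epsilon> + 36 * \<epsilon>)"
    unfolding wave_boundary_def using assms by (intro upper_dens_le_Un) blast+
  then show ?thesis by simp
qed

text \<open>Off the boundary, both floors in the branching condition move by the same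
  \<open>M\<close>, so \<open>m\<close> and \<open>n\<close> take the same branch; the parity of
  \<open>M\<close> or \<open>M'\<close> then decides whether the sign flips.\<close>

lemma mixed_wave_stable:
  assumes n: "n \<notin> wave_boundary t t' a \<epsilon>"
    and M: "\<bar>t * ln (real m) - t * ln (real n) - of_int M\<bar> < \<epsilon>" "even M \<longleftrightarrow> b"
    and M': "\<bar>t' * ln (real m) - t' * ln (real n) - of_int M'\<bar> < \<epsilon>" "even M' \<longleftrightarrow> b"
  shows "mixed_wave t t' a m = (mixed_wave t t' a n = b)"
proof -
  have "\<lfloor>t * ln (real n) + (t * ln (real m) - t * ln (real n))\<rfloor> = \<lfloor>t * ln (real n)\<rfloor> + M"
    using n M(1) by (intro floor_add_near_int[where \<epsilon> = \<epsilon>]) (auto simp: wave_boundary_def)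
  moreover have "\<lfloor>(t * ln (real n) - a) + (t * ln (real m) - t * ln (real n))\<rfloor> = \<lfloor>t * ln (real n) - a\<rfloor> + M"
    using n M(1) by (intro floor_add_near_int[where \<epsilon> = \<epsilon>]) (auto simp: wave_boundary_def algebra_simps)
  moreover have "\<lfloor>t' * ln (real n) + (t' * ln (real m) - t' * ln (real n))\<rfloor> = \<lfloor>t' * ln (real n)\<rfloor> + M'"
    using n M'(1) by (intro floor_add_near_int[where \<epsilon> = \<epsilon>]) (auto simp: wave_boundary_def)
  ultimately have "\<lfloor>t * ln (real m)\<rfloor> = \<lfloor>t * ln (real n)\<rfloor> + M" "\<lfloor>t * ln (real m) - a\<rfloor> = \<lfloor>t * ln (real n) - a\<rfloor> + M"
    "\<lfloor>t' * ln (real m)\<rfloor> = \<lfloor>t' * ln (real n)\<rfloor> + M'" by (simp_all add: algebra_simps)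
  then show ?thesis unfolding mixed_wave_def log_wave_def using M(2) M'(2) by auto
qed

lemma upper_dens_le_mixed_wave_mult:
  assumes t: "t > 0" "t' > 0" "exp (1 / t) \<le> 9" "exp (1 / t') \<le> 9" "\<epsilon> > 0"
    and M: "\<bar>t * ln (real p) - of_int M\<bar> < \<epsilon>" "even M \<longleftrightarrow> b"
    and M': "\<bar>t' * ln (real p) - of_int M'\<bar> < \<epsilon>" "even M' \<longleftrightarrow> b" and p: "p > 0"
  shows "upper_dens_le {n. mixed_wave t t' a (p * n) \<noteq> (mixed_wave t t' a n = b)} (108 * \<epsilon>)"
proof (rule upper_dens_le_mono[OF upper_dens_le_wave_boundary[OF t] _ order.refl])
  show "{n. mixed_wave t t' a (p * n) \<noteq> (mixed_wave t t' a n = b)} \<inter> {1..} \<subseteq> wave_boundary t t' a \<epsilon>"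
  proof
    fix n assume "n \<in> {n. mixed_wave t t' a (p * n) \<noteq> (mixed_wave t t' a n = b)} \<inter> {1..}"
    then have ne: "mixed_wave t t' a (p * n) \<noteq> (mixed_wave t t' a n = b)" and "n \<ge> 1" by auto
    then have ln: "s * ln (real (p * n)) - s * ln (real n) = s * ln (real p)" for s :: real
      using p by (simp add: ln_mult algebra_simps)
    show "n \<in> wave_boundary t t' a \<epsilon>"
    proof (rule ccontr)
      assume "n \<notin> wave_boundary t t' a \<epsilon>"
      from mixed_wave_stable[OF this, of "p * n" M b M'] ln M M' ne show False by simp
    qed
  qed
qed

lemma null_dens_mixed_wave_Suc:
  assumes t: "t > 0" "t' > 0" "exp (1 / t) \<le> 9" "exp (1 / t') \<le> 9"
  shows "null_dens {n. mixed_wave t t' a (n + 1) \<noteq> mixed_wave t t' a n}"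
  unfolding null_dens_def
proof (intro allI impI)
  fix d :: real assume d: "d > 0"
  \<comment> \<open>Half of \<open>d\<close> pays for the boundary (108\<epsilon> = d/2), half for
    the finitely many small \<open>n\<close>.\<close>
  define \<epsilon> where "\<epsilon> = d / 216"
  have \<epsilon>: "\<epsilon> > 0" using d by (simp add: \<epsilon>_def)
  have "(\<lambda>n::nat. s * ln (real (n + 1)) - s * ln (real n)) \<longlonglongrightarrow> 0" if "s > 0" for s :: real
    using that by real_asymp
  from tendstoD[OF this \<epsilon>] t(1,2)
  have "\<forall>\<^sub>F n::nat in sequentially. \<bar>t * ln (real (n + 1)) - t * ln (real n)\<bar> < \<epsilon> \<and> \<bar>t' * ln (real (n + 1)) - t' * ln (real n)\<bar> < \<epsilon>"
    by (auto simp: dist_real_def intro: eventually_conj)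
  then obtain n0 where n0: "\<And>n. n \<ge> n0 \<Longrightarrow> \<bar>t * ln (real (n + 1)) - t * ln (real n)\<bar> < \<epsilon> \<and> \<bar>t' * ln (real (n + 1)) - t' * ln (real n)\<bar> < \<epsilon>"
    unfolding eventually_sequentially by blast
  have "upper_dens_le (wave_boundary t t' a \<epsilon> \<union> {..<n0}) (108 * \<epsilon> + d / 2)"
    using t \<epsilon> d by (intro upper_dens_le_Un upper_dens_le_wave_boundary upper_dens_le_finite) auto
  moreover have "{n. mixed_wave t t' a (n + 1) \<noteq> mixed_wave t t' a n} \<inter> {1..} \<subseteq> wave_boundary t t' a \<epsilon> \<union> {..<n0}"
  proof (rule subsetI, rule ccontr)
    fix n assume "n \<in> {n. mixed_wave t t' a (n + 1) \<noteq> mixed_wave t t' a n} \<inter> {1..}"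
      "n \<notin> wave_boundary t t' a \<epsilon> \<union> {..<n0}"
    then show False
      using mixed_wave_stable[of n t t' a \<epsilon> "n + 1" 0 True 0] n0[of n] by auto
  qed
  ultimately show "upper_dens_le {n. mixed_wave t t' a (n + 1) \<noteq> mixed_wave t t' a n} d"
    by (rule upper_dens_le_mono) (simp add: \<epsilon>_def)
qed

text \<open>The floor of \<open>t * ln n - a\<close> changes on subtracting \<open>d\<close> only in
  a window of width \<open>d\<close>, whose bound is 2 * 9 * d.\<close>

lemma upper_dens_le_mixed_wave_diff:
  assumes "t > 0" "exp (1 / t) \<le> 9" "d > 0"
  shows "upper_dens_le {n. mixed_wave t t' a n \<noteq> mixed_wave t t' (a + d) n} (18 * d)"
proof (rule upper_dens_le_mono[OF upper_dens_le_log_window[OF assms(1,3), of a]])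
  have "\<lfloor>w - d\<rfloor> = \<lfloor>w\<rfloor>" if "\<not> frac w < d" for w
    using that assms(3) by (intro floor_unique) (auto simp: frac_def; linarith)+
  then have "mixed_wave t t' a n = mixed_wave t t' (a + d) n" if "\<not> frac (t * ln (real n) - a) < d" for n
    using that by (simp add: mixed_wave_def diff_diff_eq[symmetric])
  then show "{n. mixed_wave t t' a n \<noteq> mixed_wave t t' (a + d) n} \<inter> {1..} \<subseteq> {n. frac (t * ln (real n) - a) < d}"
    by blast
qed (use assms in auto)

text \<open>With \<open>k = floor_sqrt m\<close>, stage \<open>m\<close> is step
  \<open>m - k^2\<close> of the passage from \<open>t k\<close> to \<open>t (Suc k)\<close>:
  consecutive squares differ by 2k + 1, the number of steps.\<close>

lemma exists_wave_sequence:
  fixes e :: "nat \<Rightarrow> bool"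
  assumes "\<not> e 3"
  obtains \<sigma> :: "nat \<Rightarrow> nat \<Rightarrow> bool" where
    "\<And>m. upper_dens_le {n. \<sigma> m n \<noteq> \<sigma> (Suc m) n} (18 / (2 * real (floor_sqrt m) + 1))"
    "\<And>m p. prime p \<Longrightarrow> p \<le> floor_sqrt m \<Longrightarrow>
       upper_dens_le {n. \<sigma> m (p * n) \<noteq> (\<sigma> m n = e p)} (108 / (real (floor_sqrt m) + 2))"
    "\<And>m. null_dens {n. \<sigma> m (n + 1) \<noteq> \<sigma> m n}"
proof -
  \<comment> \<open>The accuracy \<open>1 / (real k + 2)\<close> tends to 0 and is at most 1/2 even
    for \<open>k = 0\<close>.\<close>
  have "\<forall>k::nat. \<exists>t>0. exp (1 / t) \<le> 9 \<and> (\<forall>p\<le>k. prime p \<longrightarrow>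
      (\<exists>M::int. \<bar>t * ln (real p) - of_int M\<bar> < 1 / (real k + 2) \<and> (even M \<longleftrightarrow> e p)))"
    by (intro allI exists_frequency assms) (auto simp: field_simps)
  then obtain t where t0: "\<And>k. t k > 0" and t9: "\<And>k. exp (1 / t k) \<le> 9"
    and M: "\<And>k p. p \<le> k \<Longrightarrow> prime p \<Longrightarrow>
      \<exists>M::int. \<bar>t k * ln (real p) - of_int M\<bar> < 1 / (real k + 2) \<and> (even M \<longleftrightarrow> e p)"
    by metis
  define a where "a m = real (m - (floor_sqrt m)\<^sup>2) / (2 * real (floor_sqrt m) + 1)" for m
  define \<sigma> where "\<sigma> m = mixed_wave (t (floor_sqrt m)) (t (Suc (floor_sqrt m))) (a m)" for m
  show thesis
  proof
    fix m
    define k where "k = floor_sqrt m"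
    have k: "k\<^sup>2 \<le> m" "m < (Suc k)\<^sup>2"
      unfolding k_def by (simp_all add: Suc_floor_sqrt_power2_gt)
    \<comment> \<open>The last step before a square reaches threshold 1, the pure wave of the next
      frequency, which is also the start of the next passage with threshold 0.\<close>
    have nxt: "\<sigma> (Suc m) = mixed_wave (t k) (t (Suc k)) (a m + 1 / (2 * real k + 1))"
    proof (cases "Suc m < (Suc k)\<^sup>2")
      case True
      have "floor_sqrt (Suc m) = k"
        by (rule floor_sqrt_unique) (use k True in auto)
      moreover from this have "a (Suc m) = a m + 1 / (2 * real k + 1)"
        using k unfolding a_def k_def[symmetric] by (simp add: Suc_diff_le add_divide_distrib)
      ultimately show ?thesis unfolding \<sigma>_def by simp
    next
      case False
      with k have eq: "Suc m = (Suc k)\<^sup>2" by simp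
      then have s: "floor_sqrt (Suc m) = Suc k" by (simp only: floor_sqrt_inverse_power2)
      have "a (Suc m) = 0" unfolding a_def s eq by simp
      then have 1: "\<sigma> (Suc m) = log_wave (t (Suc k))" unfolding \<sigma>_def s by (simp add: mixed_wave_0)
      have "m - k\<^sup>2 = 2 * k" using eq by (simp add: power2_eq_square)
      then have "a m = 2 * real k / (2 * real k + 1)" unfolding a_def k_def[symmetric] by simp
      then have "a m + 1 / (2 * real k + 1) = 1" by (simp add: add_divide_distrib[symmetric])
      with 1 show ?thesis by (simp add: mixed_wave_1)
    qed
    show "upper_dens_le {n. \<sigma> m n \<noteq> \<sigma> (Suc m) n} (18 / (2 * real (floor_sqrt m) + 1))"
      unfolding nxt using upper_dens_le_mixed_wave_diff[OF t0 t9, of "1 / (2 * real k + 1)" k]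
      by (simp add: \<sigma>_def k_def)
    show "null_dens {n. \<sigma> m (n + 1) \<noteq> \<sigma> m n}"
      unfolding \<sigma>_def by (intro null_dens_mixed_wave_Suc t0 t9)
  next
    fix m p :: nat
    define k where "k = floor_sqrt m"
    assume p: "prime p" "p \<le> floor_sqrt m"
    obtain M1 :: int where M1: "\<bar>t k * ln (real p) - of_int M1\<bar> < 1 / (real k + 2)" "even M1 \<longleftrightarrow> e p"
      using M[of p k] p k_def by blast
    obtain M2 :: int where M2: "\<bar>t (Suc k) * ln (real p) - of_int M2\<bar> < 1 / (real (Suc k) + 2)" "even M2 \<longleftrightarrow> e p"
      using M[of p "Suc k"] p k_def le_SucI by blast
    have "1 / (real (Suc k) + 2) \<le> 1 / (real k + 2)" by (simp add: field_simps)
    with M2(1) have M2': "\<bar>t (Suc k) * ln (real p) - of_int M2\<bar> < 1 / (real k + 2)" by linarith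
    show "upper_dens_le {n. \<sigma> m (p * n) \<noteq> (\<sigma> m n = e p)} (108 / (real (floor_sqrt m) + 2))"
      using upper_dens_le_mixed_wave_mult[OF t0 t0 t9 t9 _ M1 M2' M2(2) prime_gt_0_nat[OF p(1)], of "a m"]
      by (simp add: \<sigma>_def k_def)
  qed
qed

subsection \<open>Gluing along rapidly growing blocks\<close>

lemma exists_block:
  fixes x :: "nat \<Rightarrow> nat"
  assumes "strict_mono x" "x 0 \<le> N"
  obtains m where "x m \<le> N" "N < x (Suc m)"
proof -
  have "N < x (Suc N)" using strict_mono_imp_increasing[OF assms(1), of "Suc N"] by simp
  then have L: "N < x (LEAST m. N < x m)" by (rule LeastI)
  then obtain m where m: "(LEAST m. N < x m) = Suc m"
    using assms(2) by (cases "LEAST m. N < x m") auto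
  then have "\<not> N < x m" using not_less_Least[of m "\<lambda>m. N < x m"] by simp
  with L m show thesis by (intro that[of m]) auto
qed

text \<open>Up to \<open>N\<close>, only the block of \<open>N\<close> and the one before it matter:
  all earlier blocks lie below \<open>x l\<close>, a vanishing proportion of \<open>N\<close> by the
  growth of \<open>x\<close>.\<close>

lemma null_dens_if_blockwise:
  fixes x :: "nat \<Rightarrow> nat" and \<delta> :: "nat \<Rightarrow> real"
  assumes x: "strict_mono x" "\<And>m. Suc m * x m \<le> x (Suc m)"
    and \<delta>: "\<delta> \<longlonglongrightarrow> 0"
    and cnt: "\<And>m N. m \<ge> m0 \<Longrightarrow> N \<ge> x m \<Longrightarrow> real (card (A m \<inter> {1..N})) \<le> \<delta> m * real N"
    and sub: "\<And>m n. m \<ge> m0 \<Longrightarrow> x m \<le> n \<Longrightarrow> n < x (Suc m) \<Longrightarrow> n \<in> B \<Longrightarrow> n \<in> A m"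
  shows "null_dens B"
  unfolding null_dens_def
proof (intro allI impI)
  fix d :: real assume d: "d > 0"
  have "(\<lambda>m. 1 / real (Suc m) + \<delta> m + \<delta> (Suc m)) \<longlonglongrightarrow> 0 + 0 + 0"
    by (intro tendsto_add \<delta> LIMSEQ_Suc[OF \<delta>]) real_asymp
  then have "(\<lambda>m. 1 / real (Suc m) + \<delta> m + \<delta> (Suc m)) \<longlonglongrightarrow> 0" by simp
  from order_tendstoD(2)[OF this d] obtain m1
    where m1: "\<And>m. m \<ge> m1 \<Longrightarrow> 1 / real (Suc m) + \<delta> m + \<delta> (Suc m) < d"
    unfolding eventually_sequentially by blast
  define M where "M = max m0 m1"
  show "upper_dens_le B d"
    unfolding upper_dens_le_def eventually_sequentially
  proof (intro exI allI impI)
    fix N assume N: "x (Suc M) \<le> N"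
    have "x 0 \<le> N" using N strict_mono_less_eq[OF x(1), of 0 "Suc M"] by simp
    then obtain m where m: "x m \<le> N" "N < x (Suc m)" using exists_block[OF x(1)] by blast
    have "x (Suc M) < x (Suc m)" using N m(2) by simp
    then have "M < m" using strict_mono_less[OF x(1)] by simp
    then obtain l where l: "m = Suc l" "l \<ge> M" by (cases m) auto
    have "B \<inter> {1..N} \<subseteq> {1..x l} \<union> (A l \<inter> {1..N}) \<union> (A (Suc l) \<inter> {1..N})"
    proof
      fix n assume n: "n \<in> B \<inter> {1..N}"
      consider "n < x l" | "x l \<le> n" "n < x (Suc l)" | "x (Suc l) \<le> n" by linarith
      then show "n \<in> {1..x l} \<union> (A l \<inter> {1..N}) \<union> (A (Suc l) \<inter> {1..N})"
        using n sub[of l n] sub[of "Suc l" n] m l by cases (auto simp: M_def)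
    qed
    then have "card (B \<inter> {1..N}) \<le> card ({1..x l} \<union> (A l \<inter> {1..N}) \<union> (A (Suc l) \<inter> {1..N}))"
      by (intro card_mono) auto
    also have "\<dots> \<le> card {1..x l} + card (A l \<inter> {1..N}) + card (A (Suc l) \<inter> {1..N})"
      by (intro order_trans[OF card_Un_le] add_right_mono card_Un_le)
    finally have "real (card (B \<inter> {1..N})) \<le> real (x l) + real (card (A l \<inter> {1..N})) + real (card (A (Suc l) \<inter> {1..N}))"
      by simp
    moreover have "real (card (A l \<inter> {1..N})) \<le> \<delta> l * real N"
      using l m strict_mono_less[OF x(1), of l "Suc l"] by (intro cnt) (auto simp: M_def)
    moreover have "real (card (A (Suc l) \<inter> {1..N})) \<le> \<delta> (Suc l) * real N"
      using l m by (intro cnt) (auto simp: M_def)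
    moreover have "real (x l) \<le> 1 / real (Suc l) * real N"
    proof -
      have "Suc l * x l \<le> N" using x(2)[of l] m(1) l(1) by simp
      then have "real (Suc l) * real (x l) \<le> real N" by (metis of_nat_mult of_nat_le_iff)
      then show ?thesis by (simp add: field_simps)
    qed
    ultimately have "real (card (B \<inter> {1..N})) \<le> (1 / real (Suc l) + \<delta> l + \<delta> (Suc l)) * real N"
      by (simp add: algebra_simps)
    also have "\<dots> \<le> d * real N"
      using m1[of l] l by (intro mult_right_mono) (auto simp: M_def)
    finally show "real (card (B \<inter> {1..N})) \<le> d * real N" .
  qed
qed

lemma exists_rapid_sequence:
  fixes T :: "nat \<Rightarrow> nat"
  obtains x :: "nat \<Rightarrow> nat" where "strict_mono x" "\<And>m. T m \<le> x m" "\<And>m. Suc m * x m \<le> x (Suc m)"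
proof -
  \<comment> \<open>The factorial gives the growth by a factor \<open>Suc m\<close>; the partial
    sums dominate \<open>T\<close> and make it strict.\<close>
  define x where "x m = (\<Sum>i\<le>m. Suc (T i)) * fact m" for m
  have 1: "T m \<le> x m" for m
  proof -
    have "T m \<le> (\<Sum>i\<le>m. Suc (T i))"
      using member_le_sum[of m "{..m}" "\<lambda>i. Suc (T i)"] by simp
    also have "\<dots> \<le> x m" unfolding x_def by (simp add: fact_ge_1)
    finally show ?thesis .
  qed
  have 2: "Suc m * x m < x (Suc m)" for m
  proof -
    have "x (Suc m) = Suc m * x m + Suc (T (Suc m)) * fact (Suc m)"
      unfolding x_def by (simp add: algebra_simps)
    then show ?thesis by simp
  qed
  have "x m < x (Suc m)" for m using 2[of m] by simp
  then have "strict_mono x" by (simp add: strict_mono_Suc_iff)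
  with 1 2 that show thesis by (meson less_imp_le)
qed

text \<open>The glued function equals \<open>\<sigma> m\<close> on a block \<open>[x m, x (Suc m))\<close>. Since \<open>\<phi> q n\<close> lies in the block of \<open>n\<close>
  or in the next one, one compares it with both \<open>\<sigma> m\<close> and \<open>\<sigma> (Suc m)\<close>.\<close>
lemma exists_glued_function:
  fixes \<sigma> :: "nat \<Rightarrow> nat \<Rightarrow> bool" and \<phi> :: "nat \<Rightarrow> nat \<Rightarrow> nat" and b :: "nat \<Rightarrow> bool"
    and \<gamma> :: "nat \<Rightarrow> nat \<Rightarrow> real"
  assumes \<phi>: "\<And>q n. q \<in> Q \<Longrightarrow> n \<ge> 1 \<Longrightarrow> n \<le> \<phi> q n \<and> \<phi> q n \<le> Suc q * n"
    and \<gamma>: "\<And>q. q \<in> Q \<Longrightarrow> \<gamma> q \<longlonglongrightarrow> 0"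
    and dens: "\<And>q. q \<in> Q \<Longrightarrow> \<forall>\<^sub>F m in sequentially. upper_dens_le
      {n. \<sigma> m (\<phi> q n) \<noteq> (\<sigma> m n = b q) \<or> \<sigma> (Suc m) (\<phi> q n) \<noteq> (\<sigma> m n = b q)} (\<gamma> q m)"
  obtains S :: "nat \<Rightarrow> bool" where "\<And>q. q \<in> Q \<Longrightarrow> null_dens {n. S (\<phi> q n) \<noteq> (S n = b q)}"
proof -
  define A where "A q m = {n. \<sigma> m (\<phi> q n) \<noteq> (\<sigma> m n = b q) \<or> \<sigma> (Suc m) (\<phi> q n) \<noteq> (\<sigma> m n = b q)}" for q m
  \<comment> \<open>Only the finitely many \<open>q \<le> m\<close> are considered at stage
    \<open>m\<close>, so one threshold serves them all; \<open>T \<ge> 1\<close> will keep 0 out of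
    the blocks.\<close>
  have "\<exists>T\<ge>1. \<forall>N\<ge>T. \<forall>q\<in>{q. q \<le> m \<and> upper_dens_le (A q m) (\<gamma> q m)}. real (card (A q m \<inter> {1..N})) \<le> \<gamma> q m * real N" for m
  proof -
    have "\<forall>\<^sub>F N in sequentially. \<forall>q\<in>{q. q \<le> m \<and> upper_dens_le (A q m) (\<gamma> q m)}. real (card (A q m \<inter> {1..N})) \<le> \<gamma> q m * real N"
      by (rule eventually_ball_finite) (auto simp: upper_dens_le_def)
    then obtain T where "\<forall>N\<ge>T. \<forall>q\<in>{q. q \<le> m \<and> upper_dens_le (A q m) (\<gamma> q m)}. real (card (A q m \<inter> {1..N})) \<le> \<gamma> q m * real N"
      unfolding eventually_sequentially by blast
    then show ?thesis by (intro exI[of _ "max 1 T"]) auto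
  qed
  then obtain T where T1: "\<And>m. T m \<ge> 1"
    and T: "\<And>m N q. N \<ge> T m \<Longrightarrow> q \<le> m \<Longrightarrow> upper_dens_le (A q m) (\<gamma> q m) \<Longrightarrow> real (card (A q m \<inter> {1..N})) \<le> \<gamma> q m * real N"
    by (simp only: mem_Collect_eq Ball_def) metis
  obtain x where x: "strict_mono x" "\<And>m. T m \<le> x m" "\<And>m. Suc m * x m \<le> x (Suc m)"
    using exists_rapid_sequence[of T] by blast
  define S where "S n = \<sigma> (GREATEST m. x m \<le> n) n" for n
  have S: "S n = \<sigma> m n" if "x m \<le> n" "n < x (Suc m)" for m n
  proof -
    have "(GREATEST m. x m \<le> n) = m"
    proof (rule Greatest_equality)
      fix k assume "x k \<le> n"
      then have "x k < x (Suc m)" using that(2) by simp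
      then show "k \<le> m" using strict_mono_less[OF x(1)] by simp
    qed (rule that)
    then show ?thesis by (simp add: S_def)
  qed
  show thesis
  proof
    fix q assume q: "q \<in> Q"
    from dens[OF q] obtain m1 where m1: "\<And>m. m \<ge> m1 \<Longrightarrow> upper_dens_le (A q m) (\<gamma> q m)"
      unfolding A_def eventually_sequentially by blast
    show "null_dens {n. S (\<phi> q n) \<noteq> (S n = b q)}"
    proof (rule null_dens_if_blockwise[OF x(1,3) \<gamma>[OF q], of "max q m1" "A q"])
      fix m N assume "max q m1 \<le> m" "x m \<le> N"
      then show "real (card (A q m \<inter> {1..N})) \<le> \<gamma> q m * real N"
        using m1 x(2)[of m] by (intro T) auto
    next
      fix m n assume m: "max q m1 \<le> m" and n: "x m \<le> n" "n < x (Suc m)" "n \<in> {n. S (\<phi> q n) \<noteq> (S n = b q)}"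
      have "n \<ge> 1" using T1[of m] x(2)[of m] n(1) by linarith
      with \<phi>[OF q] have ph: "n \<le> \<phi> q n" "\<phi> q n \<le> Suc q * n" by auto
      \<comment> \<open>Since \<open>q \<le> m\<close>, the growth of \<open>x\<close> prevents
        \<open>\<phi> q\<close> from skipping a whole block.\<close>
      have "\<phi> q n < x (Suc (Suc m))"
      proof -
        note ph(2)
        also have "Suc q * n \<le> Suc (Suc m) * n" using m by (intro mult_right_mono) auto
        also have "\<dots> < Suc (Suc m) * x (Suc m)" using n(2) by (intro mult_strict_left_mono) auto
        also have "\<dots> \<le> x (Suc (Suc m))" by (rule x(3))
        finally show ?thesis .
      qed
      then have "S (\<phi> q n) = \<sigma> m (\<phi> q n) \<or> S (\<phi> q n) = \<sigma> (Suc m) (\<phi> q n)"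
        using S[of m "\<phi> q n"] S[of "Suc m" "\<phi> q n"] ph(1) n(1) by (cases "\<phi> q n < x (Suc m)") auto
      then show "n \<in> A q m" using n(3) S[OF n(1,2)] unfolding A_def by auto
    qed
  qed
qed

subsection \<open>The mod 3 character and the theorem\<close>

text \<open>The completely multiplicative extension of the non-principal character modulo 3 with value 1 at 3
  (the value at 0 is irrelevant).\<close>
fun chi3 :: "nat \<Rightarrow> real" where
  "chi3 n = (if n = 0 then 1 else if 3 dvd n then chi3 (n div 3) else if n mod 3 = 1 then 1 else - 1)"

declare chi3.simps [simp del]

lemma chi3_cases: "chi3 n = 1 \<or> chi3 n = - 1"
  by (induction n rule: chi3.induct) (subst (1 2) chi3.simps, auto)

lemma chi3_3_mult: "chi3 (3 * n) = chi3 n"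
  by (cases "n = 0") (simp_all add: chi3.simps[of "3 * n"])

lemma chi3_mod_3_eq_1: "n mod 3 = 1 \<Longrightarrow> chi3 n = 1"
  by (subst chi3.simps) auto

lemma chi3_mod_3_eq_2: "n mod 3 = 2 \<Longrightarrow> chi3 n = - 1"
  by (subst chi3.simps) auto

lemma chi3_3: "chi3 3 = 1"
  using chi3_3_mult[of 1] by (simp add: chi3_mod_3_eq_1)

text \<open>For \<open>p\<close> other than 3, factors 3 are stripped from \<open>n\<close> until
  only residues modulo 3 matter.\<close>

lemma chi3_prime_mult:
  assumes "prime p" "n \<ge> 1"
  shows "chi3 (p * n) = chi3 p * chi3 n"
proof (cases "3 dvd p")
  case True
  then have "p = 3" using assms(1) using primes_dvd_imp_eq[of 3 p] by simp
  then show ?thesis by (simp add: chi3_3_mult chi3_3)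
next
  case False
  show ?thesis
    using assms(2)
  proof (induction n rule: less_induct)
    case (less n)
    show ?case
    proof (cases "3 dvd n")
      case True
      then obtain m where m: "n = 3 * m" by blast
      with less have "chi3 (p * m) = chi3 p * chi3 m" by simp
      moreover have "p * n = 3 * (p * m)" using m by simp
      ultimately show ?thesis using m by (simp only: chi3_3_mult)
    next
      case n: False
      have "p mod 3 = 1 \<or> p mod 3 = 2" "n mod 3 = 1 \<or> n mod 3 = 2"
        using False n by (auto simp: dvd_eq_mod_eq_0)
      moreover have "(p * n) mod 3 = ((p mod 3) * (n mod 3)) mod 3" by (simp add: mod_mult_eq)
      ultimately show ?thesis by (elim disjE) (simp_all add: chi3_mod_3_eq_1 chi3_mod_3_eq_2)
    qed
  qed
qed

text \<open>Read as a sign s, \<open>S\<close> satisfies s(pn) = -chi(p) s(n) almost everywhere: the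
  sign is kept exactly when chi(p) = -1.\<close>

lemma exists_slowly_varying:
  obtains S :: "nat \<Rightarrow> bool" where
    "\<And>p. prime p \<Longrightarrow> null_dens {n. S (p * n) \<noteq> (S n = (chi3 p = - 1))}"
    "null_dens {n. S (n + 1) \<noteq> S n}"
proof -
  define e where "e p \<longleftrightarrow> chi3 p = - 1" for p
  have "\<not> e 3" by (simp add: e_def chi3_3)
  then obtain \<sigma> where \<sigma>: 
    "\<And>m. upper_dens_le {n. \<sigma> m n \<noteq> \<sigma> (Suc m) n} (18 / (2 * real (floor_sqrt m) + 1))"
    "\<And>m p. prime p \<Longrightarrow> p \<le> floor_sqrt m \<Longrightarrow>
       upper_dens_le {n. \<sigma> m (p * n) \<noteq> (\<sigma> m n = e p)} (108 / (real (floor_sqrt m) + 2))"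
    "\<And>m. null_dens {n. \<sigma> m (n + 1) \<noteq> \<sigma> m n}"
    using exists_wave_sequence by blast
  have lim: "filterlim floor_sqrt sequentially sequentially"
    unfolding filterlim_at_top
  proof
    fix k show "\<forall>\<^sub>F m in sequentially. k \<le> floor_sqrt m"
      using eventually_ge_at_top[of "k\<^sup>2"] by eventually_elim (rule le_floor_sqrtI)
  qed
  define \<delta> where "\<delta> m = 18 / (2 * real (floor_sqrt m) + 1)" for m
  define \<epsilon> where "\<epsilon> m = 108 / (real (floor_sqrt m) + 2)" for m
  have \<delta>: "\<delta> \<longlonglongrightarrow> 0" unfolding \<delta>_def
    by (rule filterlim_compose[OF _ lim, of "\<lambda>k. 18 / (2 * real k + 1)"]) real_asymp
  have \<epsilon>: "\<epsilon> \<longlonglongrightarrow> 0" unfolding \<epsilon>_def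
    by (rule filterlim_compose[OF _ lim, of "\<lambda>k. 108 / (real k + 2)"]) real_asymp
  have \<epsilon>0: "\<epsilon> m > 0" and \<delta>0: "\<delta> m > 0" for m by (simp_all add: \<epsilon>_def \<delta>_def add_nonneg_pos)
  text \<open>1 is not a prime, so that this index is free for the shift \<open>n + 1\<close>.\<close>
  define \<phi> :: "nat \<Rightarrow> nat \<Rightarrow> nat" where "\<phi> q n = (if q = 1 then n + 1 else q * n)" for q n
  define b where "b q \<longleftrightarrow> q = 1 \<or> e q" for q
  have "\<forall>\<^sub>F m in sequentially. upper_dens_le
      {n. \<sigma> m (\<phi> q n) \<noteq> (\<sigma> m n = b q) \<or> \<sigma> (Suc m) (\<phi> q n) \<noteq> (\<sigma> m n = b q)} (\<epsilon> m + real (Suc q) * \<delta> m)"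
    if q: "q \<in> insert 1 {p. prime p}" for q
    using eventually_compose_filterlim[OF eventually_ge_at_top[of q] lim]
  proof eventually_elim
    case (elim m)
    have 1: "upper_dens_le {n. \<sigma> m (\<phi> q n) \<noteq> (\<sigma> m n = b q)} (\<epsilon> m)"
    proof (cases "q = 1")
      case True
      then show ?thesis using \<sigma>(3)[of m] \<epsilon>0[of m] by (simp add: \<phi>_def b_def null_dens_def)
    next
      case False
      then show ?thesis using \<sigma>(2)[of q m] q elim by (simp add: \<phi>_def b_def \<epsilon>_def)
    qed
    \<comment> \<open>Replacing stage \<open>m\<close> by the next one at \<open>\<phi> q n\<close>
      costs a factor \<open>q\<close> for multiplication and 2 for the shift; \<open>Suc q\<close>
      covers both.\<close>
    have 2: "upper_dens_le {n. \<sigma> m (\<phi> q n) \<noteq> \<sigma> (Suc m) (\<phi> q n)} (real (Suc q) * \<delta> m)"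
    proof (cases "q = 1")
      case True
      then show ?thesis
        using upper_dens_le_vimage_add[OF \<sigma>(1)[of m], of 1] \<delta>0[of m] by (simp add: \<phi>_def \<delta>_def)
    next
      case False
      then have "q > 0" using q by (auto intro: prime_gt_0_nat)
      from upper_dens_le_vimage_mult[OF \<sigma>(1)[of m] this]
      show ?thesis using False \<delta>0[of m]
        by (elim upper_dens_le_mono) (auto simp: \<phi>_def \<delta>_def[symmetric] mult_right_mono)
    qed
    show ?case by (rule upper_dens_le_mono[OF upper_dens_le_Un[OF 1 2]]) auto
  qed
  moreover have "(\<lambda>m. \<epsilon> m + real (Suc q) * \<delta> m) \<longlonglongrightarrow> 0" for q
    using tendsto_add[OF \<epsilon> tendsto_mult_left[OF \<delta>, of "real (Suc q)"]] by simp
  moreover have "n \<le> \<phi> q n \<and> \<phi> q n \<le> Suc q * n" if "q \<in> insert 1 {p. prime p}" "n \<ge> 1" for q n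
    using that by (auto simp: \<phi>_def dest: prime_gt_0_nat)
  ultimately obtain S where S: "\<And>q. q \<in> insert 1 {p. prime p} \<Longrightarrow> null_dens {n. S (\<phi> q n) \<noteq> (S n = b q)}"
    using exists_glued_function[of "insert 1 {p. prime p}" \<phi> "\<lambda>q m. \<epsilon> m + real (Suc q) * \<delta> m" \<sigma> b] by blast
  show thesis
  proof
    show "null_dens {n. S (p * n) \<noteq> (S n = (chi3 p = - 1))}" if "prime p" for p
    proof -
      have "p \<noteq> 1" using that by auto
      then show ?thesis using S[of p] that by (simp add: \<phi>_def b_def e_def)
    qed
    show "null_dens {n. S (n + 1) \<noteq> S n}"
      using S[of 1] by (simp add: \<phi>_def b_def)
  qed
qed

section \<open>Mean values of the character correlation and of the class 1 mod 3\<close>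

lemma tendsto_average_chi3_corr:
  "(\<lambda>N. (\<Sum>n=1..N. chi3 n * chi3 (n + 1)) / real N) \<longlonglongrightarrow> - 1 / 3"
proof (rule tendsto_average_mod_3)
  fix m
  \<comment> \<open>The value at \<open>3 * m + 3\<close> is unknown, but its neighbours have
    opposite signs, so its two products cancel and only -1 remains.\<close>
  have "chi3 (3 * m + 1) = 1" "chi3 (3 * m + 2) = - 1" "chi3 (3 * m + 4) = 1"
    by (auto intro!: chi3_mod_3_eq_1 chi3_mod_3_eq_2; presburger)+
  then show "chi3 (3 * m + 1) * chi3 (3 * m + 1 + 1) + chi3 (3 * m + 2) * chi3 (3 * m + 2 + 1)
      + chi3 (3 * m + 3) * chi3 (3 * m + 3 + 1) = 3 * (- 1 / 3)"
    by (simp add: numeral_eq_Suc)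
next
  show "\<bar>chi3 n * chi3 (n + 1)\<bar> \<le> 1" for n
    using chi3_cases[of n] chi3_cases[of "n + 1"] by auto
qed

text \<open>For fixed \<open>h\<close>, each block of three consecutive \<open>n\<close> contains
  exactly one hit; averaging over \<open>h\<close> preserves the mean 1/3.\<close>

lemma tendsto_average_residue_count:
  assumes "H \<ge> 1"
  shows "(\<lambda>N. (\<Sum>n=1..N. (1 / real H) * (\<Sum>h=1..H. of_bool ([n + h = 1] (mod 3)))) / real N)
    \<longlonglongrightarrow> (1 / 3 :: real)"
proof -
  have "(\<lambda>N. (\<Sum>n=1..N. of_bool ([n + h = 1] (mod 3))) / real N) \<longlonglongrightarrow> (1 / 3 :: real)" for h
  proof (rule tendsto_average_mod_3[where C = 1])
    fix m
    show "of_bool ([3 * m + 1 + h = 1] (mod 3)) + of_bool ([3 * m + 2 + h = 1] (mod 3))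
        + of_bool ([3 * m + 3 + h = 1] (mod 3)) = 3 * (1 / 3 :: real)"
    proof -
      have counts: "of_bool ([3 * m + 1 + h = 1] (mod 3)) = (of_bool (h mod 3 = 0) :: real)"
        "of_bool ([3 * m + 2 + h = 1] (mod 3)) = (of_bool (h mod 3 = 2) :: real)"
        "of_bool ([3 * m + 3 + h = 1] (mod 3)) = (of_bool (h mod 3 = 1) :: real)"
        unfolding Cong.cong_def of_bool_eq_iff by presburger+
      consider "h mod 3 = 0" | "h mod 3 = 1" | "h mod 3 = 2" by linarith
      then show ?thesis unfolding counts by cases simp_all
    qed
  qed simp
  then have "(\<lambda>N. (1 / real H) * (\<Sum>h=1..H. (\<Sum>n=1..N. of_bool ([n + h = 1] (mod 3))) / real N))
      \<longlonglongrightarrow> (1 / real H) * (\<Sum>h=1..H. (1 / 3 :: real))"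
    by (intro tendsto_mult_left tendsto_sum)
  moreover have "(1 / real H) * (\<Sum>h=1..H. (\<Sum>n=1..N. of_bool ([n + h = 1] (mod 3))) / real N) =
      (\<Sum>n=1..N. (1 / real H) * (\<Sum>h=1..H. of_bool ([n + h = 1] (mod 3)))) / real N" for N
    unfolding sum_divide_distrib[symmetric] sum_distrib_left[symmetric] by (subst sum.swap) simp
  ultimately show ?thesis using assms by simp
qed

theorem theorem1p8:
  shows "\<exists>f :: nat \<Rightarrow> real.
    (\<forall>n\<ge>1. f n \<in> {1, -1}) \<and>
    (\<forall>p::nat. prime p \<longrightarrow> has_natural_density {n. n \<ge> 1 \<and> f n \<noteq> - f (p * n)} 0) \<and>
    (\<exists>\<epsilon>>0. \<forall>\<^sub>F x::real in at_top.
        (1 / x) * (\<Sum>n = 1..nat \<lfloor>x\<rfloor>. f n * f (n + 1)) < - \<epsilon>) \<and>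
    (\<exists>L :: nat \<Rightarrow> real.
        (\<forall>H\<ge>1. ((\<lambda>x::real. (1 / x) * (\<Sum>n = 1..nat \<lfloor>x\<rfloor>.
            \<bar>(1 / real H) * (\<Sum>h = 1..H. f (n + h) * of_bool ([n + h = 1] (mod 3)))\<bar>))
          \<longlongrightarrow> L H) at_top) \<and>
        L \<longlonglongrightarrow> 1 / 3)"
proof -
  obtain S where S: "\<And>p. prime p \<Longrightarrow> null_dens {n. S (p * n) \<noteq> (S n = (chi3 p = - 1))}"
    "null_dens {n. S (n + 1) \<noteq> S n}"
    using exists_slowly_varying by blast
  define s :: "nat \<Rightarrow> real" where "s n = (if S n then 1 else - 1)" for n
  define f where "f n = s n * chi3 n" for n
  have s: "s n = 1 \<or> s n = - 1" for n by (simp add: s_def)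
  have f: "f n = 1 \<or> f n = - 1" for n using s[of n] chi3_cases[of n] by (auto simp: f_def)
  have "has_natural_density {n. n \<ge> 1 \<and> f n \<noteq> - f (p * n)} 0" if "prime p" for p
  proof (rule has_natural_density_0_if_null_dens, rule null_dens_mono[OF S(1)[OF that]])
    show "{n. n \<ge> 1 \<and> f n \<noteq> - f (p * n)} \<inter> {1..} \<subseteq> {n. S (p * n) \<noteq> (S n = (chi3 p = - 1))}"
      using chi3_cases[of p] by (auto simp: f_def s_def chi3_prime_mult[OF that])
  qed
  \<comment> \<open>The correlation tends to -1/3, and -1/4 leaves room above this limit.\<close>
  moreover have "\<forall>\<^sub>F x::real in at_top. (1 / x) * (\<Sum>n = 1..nat \<lfloor>x\<rfloor>. f n * f (n + 1)) < - (1 / 4)"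
  proof -
    have "(\<lambda>N. (\<Sum>n=1..N. f n * f (n + 1)) / real N) \<longlonglongrightarrow> - 1 / 3"
    proof (rule tendsto_average_modify_null[OF tendsto_average_chi3_corr S(2), where C = 2])
      show "f n * f (n + 1) = chi3 n * chi3 (n + 1)" if "n \<notin> {n. S (n + 1) \<noteq> S n}" for n
        using that by (auto simp: f_def s_def)
      show "\<bar>f n * f (n + 1) - chi3 n * chi3 (n + 1)\<bar> \<le> 2" for n
        using f[of n] f[of "n + 1"] chi3_cases[of n] chi3_cases[of "n + 1"] by auto
    qed
    from order_tendstoD(2)[OF tendsto_div_nat_floor[OF this], of "- (1 / 4)"] show ?thesis by simp
  qed
  moreover have "((\<lambda>x::real. (1 / x) * (\<Sum>n = 1..nat \<lfloor>x\<rfloor>.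
      \<bar>(1 / real H) * (\<Sum>h = 1..H. f (n + h) * of_bool ([n + h = 1] (mod 3)))\<bar>)) \<longlongrightarrow> 1 / 3) at_top"
    if H: "H \<ge> 1" for H :: nat
  proof -
    let ?g = "\<lambda>n. \<bar>(1 / real H) * (\<Sum>h = 1..H. f (n + h) * of_bool ([n + h = 1] (mod 3)))\<bar>"
    let ?c = "\<lambda>n. (1 / real H) * (\<Sum>h = 1..H. of_bool ([n + h = 1] (mod 3))) :: real"
    \<comment> \<open>Outside \<open>B\<close> the sign is constant on \<open>n, ..., n + H\<close>;
      \<open>B\<close> is null as a finite union of shifts.\<close>
    define B where "B = (\<Union>h\<in>{..H}. {n. n + h \<in> {n. S (n + 1) \<noteq> S n}})"
    have B: "null_dens B"
      unfolding B_def by (intro null_dens_UN null_dens_vimage_add S(2)) simp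
    have "(\<lambda>N. (\<Sum>n=1..N. ?g n) / real N) \<longlonglongrightarrow> 1 / 3"
    proof (rule tendsto_average_modify_null[OF tendsto_average_residue_count[OF H] B, where C = 1])
      fix n assume n: "n \<notin> B"
      have const: "S (n + h) = S n" if "h \<le> H" for h
        using that
      proof (induction h)
        case (Suc h)
        then show ?case using n by (auto simp: B_def)
      qed simp
      \<comment> \<open>On the class 1 mod 3 the character is 1, so the common sign
        \<open>s n\<close> factors out of the sum and disappears under the absolute value.\<close>
      have "f (n + h) * of_bool ([n + h = 1] (mod 3)) = s n * of_bool ([n + h = 1] (mod 3))" if "h \<in> {1..H}" for h
        using const[of h] that chi3_mod_3_eq_1[of "n + h"] by (auto simp: f_def s_def Cong.cong_def)
      then have "(\<Sum>h = 1..H. f (n + h) * of_bool ([n + h = 1] (mod 3))) = s n * (\<Sum>h = 1..H. of_bool ([n + h = 1] (mod 3)))"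
        unfolding sum_distrib_left by (intro sum.cong) auto
      moreover have "\<bar>s n\<bar> = 1" by (simp add: s_def)
      ultimately show "?g n = ?c n" by (simp add: abs_mult sum_nonneg abs_of_nonneg)
    next
      fix n
      have c: "0 \<le> ?c n" "?c n \<le> 1" 
        using sum_bounded_above[of "{1..H}" "\<lambda>h. of_bool ([n + h = 1] (mod 3))" "1::real"] H
        by (auto intro: sum_nonneg simp: field_simps)
      have "?g n \<le> (1 / real H) * (\<Sum>h = 1..H. \<bar>f (n + h) * of_bool ([n + h = 1] (mod 3))\<bar>)"
        unfolding abs_mult using sum_abs by (simp add: divide_right_mono)
      also have "\<dots> = ?c n"
      proof -
        have "\<bar>f k\<bar> = 1" for k using f[of k] by auto
        then show ?thesis by (simp add: abs_mult)
      qed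
      finally show "\<bar>?g n - ?c n\<bar> \<le> 1" using c by linarith
    qed
    from tendsto_div_nat_floor[OF this] show ?thesis by simp
  qed
  \<comment> \<open>The inner limit is already 1/3 for every \<open>H \<ge> 1\<close>, so
    \<open>L\<close> is constant.\<close>
  ultimately show ?thesis
    using f by (intro exI[of _ f] conjI exI[of _ "1 / 4 :: real"] exI[of _ "\<lambda>_. 1 / 3 :: real"]) auto
qed

end
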